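(* Let $x$ and $y$ be indeterminates and let $F_n(x,y)$, $n\ge 0$, be the Savage-Viswanathan polynomials. Let $h_n=\det\bigl(F_{i+j}(x,y)\bigr)_{0\le i,j\le n}$ be their Hankel transform. Then for all $n\ge 0$ $$h_n=x^{\binom{n+1}{2}}y^n\prod_{i=1}^n\bigl((i+1)(i+y)\bigr)^{n-i}.$$
   Context: The Savage-Viswanathan polynomials $F_n(x,y)$ are defined by the exponential generating function $\sum_{n\ge 0}F_n(x,y)\frac{z^n}{n!}=\left(\frac{1-x}{e^{z(x-1)}-x}\right)^y$ (a formal power series in $z$; the base has constant term $1$, and $u^y=\exp(y\ln u)$). They are polynomials in $x,y$. *)

theory Defs
  imports
    "HOL-Computational_Algebra.Formal_Power_Series"
    "Jordan_Normal_Form.Determinant"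
begin

instance fract :: ("{idom, ring_char_0}") field_char_0
proof
  show "inj (of_nat :: nat \<Rightarrow> 'a fract)"
    by (rule injI) (simp add: Fract_of_nat_eq [symmetric] eq_fract)
qed

text \<open>For \<open>u\<close> with constant term \<open>1\<close>, this is \<open>u\<^sup>a = exp (a ln u)\<close>; note that
  \<^term>\<open>fps_ln 1\<close> is the expansion of \<open>ln (1 + z)\<close> in \<open>z\<close>. If the constant term of
  \<open>u\<close> is not \<open>1\<close>, the value carries no meaning.\<close>
definition fps_general_power :: "'a::field_char_0 fps \<Rightarrow> 'a \<Rightarrow> 'a fps" where
  "fps_general_power u a = fps_exp 1 oo (fps_const a * (fps_ln 1 oo (u - 1)))"

text \<open>The field \<open>\<rat>(x, y)\<close>, as the fraction field of \<open>\<rat>[x][y]\<close>. The division in the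
  generating function is carried out over this field; the values \<open>F\<^sub>n(x, y)\<close> lie in the
  image of \<open>\<rat>[x, y]\<close>.\<close>
type_synonym ratfun2 = "rat poly poly fract"

definition indet_x :: ratfun2 where
  "indet_x = to_fract [:[:0, 1:]:]"

definition indet_y :: ratfun2 where
  "indet_y = to_fract [:0, 1:]"

text \<open>The two arguments may be arbitrary elements of a field of characteristic \<open>0\<close>, but
  \<open>x = 1\<close> has to be avoided: there the base of the power degenerates to \<open>0 / 0\<close>.\<close>
definition savage_viswanathan_gf :: "'a::field_char_0 \<Rightarrow> 'a \<Rightarrow> 'a fps" where
  "savage_viswanathan_gf x y =
     fps_general_power (fps_const (1 - x) / (fps_exp (x - 1) - fps_const x)) y"

definition savage_viswanathan :: "nat \<Rightarrow> 'a::field_char_0 \<Rightarrow> 'a \<Rightarrow> 'a" where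
  "savage_viswanathan n x y = fact n * fps_nth (savage_viswanathan_gf x y) n"

definition hankel_transform :: "(nat \<Rightarrow> 'a::comm_ring_1) \<Rightarrow> nat \<Rightarrow> 'a" where
  "hankel_transform f n = det (mat (n + 1) (n + 1) (\<lambda>(i, j). f (i + j)))"

end

theory Submission
  imports Defs
begin

text \<open>The base \<open>B\<close> of the power satisfies \<open>B' = B (1 + x s)\<close> with \<open>s = B - 1\<close>, hence
  \<open>s' = (1 + s) (1 + x s)\<close> and \<open>f' = y (1 + x s) f\<close> for the generating function \<open>f = B\<^sup>y\<close>.
  So the derivative sends \<open>f s\<^sup>k / k!\<close> to a combination of its two neighbours and itself,
  with off-diagonal weights \<open>1\<close> and \<open>\<lambda>\<^sub>k = x (k + 1) (k + y)\<close>. Iterating, the matrix of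
  the numbers \<open>i! [z\<^sup>i] f s\<^sup>k / k!\<close> is lower unitriangular and yields an \<open>L D L\<^sup>T\<close>
  decomposition of the Hankel matrix, where the diagonal of \<open>D\<close> consists of the products
  \<open>\<lambda>\<^sub>0 \<dots> \<lambda>\<^sub>k\<^sub>-\<^sub>1\<close>.\<close>

section \<open>Hankel determinants from a three-term recurrence\<close>

text \<open>\<open>M i k\<close> sums the weighted Motzkin paths of \<open>i\<close> steps from
  height 0 to height \<open>k\<close>: steps up weigh 1, level steps at height \<open>k\<close>
  weigh \<open>b k\<close>, steps down from \<open>Suc k\<close> to \<open>k\<close> weigh
  \<open>l k\<close>.\<close>

locale stieltjes_array =
  fixes M :: "nat \<Rightarrow> nat \<Rightarrow> 'a::comm_ring_1" and b l :: "nat \<Rightarrow> 'a"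
  assumes M_0_0: "M 0 0 = 1"
    and M_0_Suc: "M 0 (Suc k) = 0"
    and M_Suc_0: "M (Suc i) 0 = b 0 * M i 0 + l 0 * M i 1"
    and M_Suc_Suc: "M (Suc i) (Suc k) =
      M i k + b (Suc k) * M i (Suc k) + l (Suc k) * M i (Suc (Suc k))"
begin

lemma M_above_diagonal: "i < k \<Longrightarrow> M i k = 0"
proof (induction i arbitrary: k)
  case 0
  then show ?case by (cases k) (simp_all add: M_0_Suc)
next
  case (Suc i)
  then show ?case by (cases k) (simp_all add: M_Suc_Suc)
qed

lemma M_diagonal: "M i i = 1"
  by (induction i) (simp_all add: M_0_0 M_Suc_Suc M_above_diagonal)

definition weight :: "nat \<Rightarrow> 'a" where
  "weight k = (\<Prod>j<k. l j)"

definition form :: "nat \<Rightarrow> nat \<Rightarrow> nat \<Rightarrow> 'a" where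
  "form N i j = (\<Sum>k<N. weight k * M i k * M j k)"

text \<open>The recurrence operator is self-adjoint for the weights; truncating at \<open>N\<close> leaves
  only boundary terms.\<close>
lemma form_Suc_left:
  "form N (Suc i) j - form N i (Suc j) =
     (if N = 0 then 0 else weight N * (M i N * M j (N - 1) - M i (N - 1) * M j N))"
proof (induction N)
  case 0
  then show ?case by (simp add: form_def)
next
  case (Suc N)
  have "form (Suc N) (Suc i) j - form (Suc N) i (Suc j) =
      form N (Suc i) j - form N i (Suc j) +
      weight N * (M (Suc i) N * M j N - M i N * M (Suc j) N)"
    by (simp add: form_def algebra_simps)
  also have "\<dots> = weight (Suc N) * (M i (Suc N) * M j N - M i N * M j (Suc N))"
    unfolding Suc.IH
    by (cases N) (simp_all add: weight_def M_Suc_0 M_Suc_Suc algebra_simps)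
  finally show ?case by simp
qed

text \<open>Row \<open>i\<close> vanishes beyond column \<open>i\<close>, so the truncation level
  can be changed freely above \<open>i\<close>.\<close>

lemma form_eq_sum:
  assumes "i < N"
  shows "form N i j = (\<Sum>k\<le>i. weight k * M i k * M j k)"
  unfolding form_def
  by (rule sum.mono_neutral_right) (use assms in \<open>auto simp: M_above_diagonal\<close>)

text \<open>Self-adjointness moves steps from the left index to the right one until row 0 is left,
  where only column 0 contributes.\<close>

lemma form_eq:
  "i < N \<Longrightarrow> form N i j = M (i + j) 0"
proof (induction i arbitrary: j N)
  case 0
  then show ?case by (simp add: form_eq_sum weight_def M_0_0)
next
  case (Suc i)
  \<comment> \<open>\<open>N\<close> may be at most \<open>j\<close>; \<open>K\<close> exceeds both
    \<open>Suc i\<close> and \<open>j\<close>, so both boundary terms vanish.\<close>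
  define K where "K = Suc (Suc (i + j))"
  have "form N (Suc i) j = form K (Suc i) j"
    using Suc.prems by (simp add: form_eq_sum K_def)
  also have "\<dots> = form K i (Suc j)"
    using form_Suc_left[of K i j] by (simp add: K_def M_above_diagonal)
  also have "\<dots> = M (i + Suc j) 0"
    by (rule Suc.IH) (simp add: K_def)
  finally show ?case by simp
qed

lemma hankel_transform_eq:
  "hankel_transform (\<lambda>i. M i 0) n = (\<Prod>k\<le>n. \<Prod>j<k. l j)"
proof -
  define N where "N = n + 1"
  define A where "A = mat N N (\<lambda>(i, k). M i k)"
  \<comment> \<open>This is the product of the diagonal matrix of weights and the transpose of
    \<open>A\<close>.\<close>
  define B where "B = mat N N (\<lambda>(k, j). weight k * M j k)"
  have carrier: "A \<in> carrier_mat N N" "B \<in> carrier_mat N N"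
    by (simp_all add: A_def B_def)
  have "mat N N (\<lambda>(i, j). M (i + j) 0) = A * B"
  proof (rule eq_matI)
    fix i j assume "i < dim_row (A * B)" "j < dim_col (A * B)"
    then have ij: "i < N" "j < N" by (simp_all add: A_def B_def)
    have "(A * B) $$ (i, j) = form N i j"
      using ij by (simp add: A_def B_def scalar_prod_def form_def lessThan_atLeast0 mult_ac)
    then show "mat N N (\<lambda>(i, j). M (i + j) 0) $$ (i, j) = (A * B) $$ (i, j)"
      using ij by (simp add: form_eq)
  qed (simp_all add: A_def B_def)
  moreover have "det A = 1"
  proof -
    have "det A = prod_list (diag_mat A)"
      by (rule det_lower_triangular[OF _ carrier(1)]) (simp add: A_def M_above_diagonal)
    then show ?thesis by (simp add: prod_list_diag_prod A_def M_diagonal)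
  qed
  moreover have "det B = (\<Prod>k<N. weight k)"
  proof -
    have "det B = prod_list (diag_mat B)"
      by (rule det_upper_triangular[OF _ carrier(2)]) (auto simp: B_def M_above_diagonal)
    then show ?thesis
      by (simp add: prod_list_diag_prod B_def M_diagonal lessThan_atLeast0)
  qed
  ultimately show ?thesis
    using det_mult[OF carrier]
    by (simp add: hankel_transform_def N_def weight_def lessThan_Suc_atMost)
qed

end

section \<open>The generating function\<close>

lemma fps_nth_general_power_0: "fps_nth (fps_general_power u a) 0 = 1"
  by (simp add: fps_general_power_def)

text \<open>The logarithmic derivative of \<open>u\<close> to the power \<open>a\<close> is
  \<open>a\<close> times that of \<open>u\<close>; here the division by \<open>u\<close> is
  cleared.\<close>

lemma fps_deriv_general_power:
  fixes u :: "'a::field_char_0 fps"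
  assumes "fps_nth u 0 = 1"
  shows "u * fps_deriv (fps_general_power u a) =
    fps_const a * fps_deriv u * fps_general_power u a"
proof -
  define v where "v = fps_const a * (fps_ln 1 oo (u - 1))"
  have [simp]: "fps_nth v 0 = 0"
    by (simp add: v_def fps_ln_nth)
  have "inverse (1 + fps_X) oo (u - 1) = inverse u"
    by (subst fps_inverse_compose) (simp_all add: assms fps_compose_add_distrib)
  then have "fps_deriv v = fps_const a * (inverse u * fps_deriv u)"
    by (simp add: assms v_def fps_compose_deriv fps_ln_deriv)
  then have "u * fps_deriv (fps_general_power u a) =
      (u * inverse u) * (fps_const a * fps_deriv u * fps_general_power u a)"
    by (simp add: fps_general_power_def fps_compose_deriv mult_ac flip: v_def)
  also have "u * inverse u = 1"
    using assms by (simp add: inverse_mult_eq_1')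
  finally show ?thesis by simp
qed

context
  fixes x y :: "'a::field_char_0"
  assumes x_neq_1: "x \<noteq> 1"
begin

definition sv_base :: "'a fps" where
  "sv_base = fps_const (1 - x) / (fps_exp (x - 1) - fps_const x)"

text \<open>The denominator has constant term \<open>1 - x\<close>, a unit, so the division is a
  true inverse.\<close>

lemma sv_base_mult: "sv_base * (fps_exp (x - 1) - fps_const x) = fps_const (1 - x)"
  using x_neq_1 by (simp add: sv_base_def fps_divide_unit inverse_mult_eq_1 mult.assoc)

lemma sv_base_nth_0: "fps_nth sv_base 0 = 1"
  using arg_cong[OF sv_base_mult, of "\<lambda>u. fps_nth u 0"] x_neq_1 by simp

lemma fps_deriv_sv_base:
  "fps_deriv sv_base = sv_base * (1 + fps_const x * (sv_base - 1))"
proof -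
  define e where "e = fps_exp (x - 1)"
  define X where "X = fps_const x"
  have base: "sv_base * (e - X) = 1 - X"
    using sv_base_mult by (simp add: e_def X_def flip: fps_const_sub)
  have deriv_e: "fps_deriv e = (X - 1) * e"
    by (simp add: e_def X_def flip: fps_const_sub)
  have "fps_deriv sv_base * (e - X) + sv_base * ((X - 1) * e) = 0"
    using arg_cong[OF base, of fps_deriv] deriv_e by (simp add: X_def add.commute)
  \<comment> \<open>Split \<open>e\<close> as \<open>(e - X) + X\<close>. The last
    \<open>1 - X\<close> is then replaced by \<open>sv_base * (e - X)\<close>, so that
    \<open>e - X\<close> cancels and no exponential remains.\<close>
  then have "fps_deriv sv_base * (e - X) = sv_base * ((e - X) * (1 - X) + X * (1 - X))"
    by (simp add: algebra_simps add_eq_0_iff)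
  also have "\<dots> = sv_base * ((e - X) * (1 - X) + X * (sv_base * (e - X)))"
    by (simp only: base)
  also have "\<dots> = sv_base * (1 + X * (sv_base - 1)) * (e - X)"
    by (simp add: algebra_simps)
  finally have "fps_deriv sv_base * (e - X) = sv_base * (1 + X * (sv_base - 1)) * (e - X)" .
  moreover have "e - X \<noteq> 0"
    using x_neq_1 by (auto simp: fps_eq_iff e_def X_def intro!: exI[of _ 0])
  ultimately show ?thesis by (simp add: X_def)
qed

lemma fps_deriv_savage_viswanathan_gf:
  "fps_deriv (savage_viswanathan_gf x y) =
    fps_const y * (1 + fps_const x * (sv_base - 1)) * savage_viswanathan_gf x y"
proof -
  have "sv_base * fps_deriv (savage_viswanathan_gf x y) =
      sv_base * (fps_const y * (1 + fps_const x * (sv_base - 1)) * savage_viswanathan_gf x y)"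
    using fps_deriv_general_power[OF sv_base_nth_0, of y]
    by (simp add: savage_viswanathan_gf_def fps_deriv_sv_base mult_ac flip: sv_base_def)
  moreover have "sv_base \<noteq> 0"
    using sv_base_nth_0 by auto
  ultimately show ?thesis by simp
qed

text \<open>These are the columns of an exponential Riordan array; the factor
  \<open>1 / fact k\<close> normalizes the weight of steps up to 1.\<close>

definition sv_column :: "nat \<Rightarrow> 'a fps" where
  "sv_column k = fps_const (1 / fact k) * savage_viswanathan_gf x y * (sv_base - 1) ^ k"

definition sv_array :: "nat \<Rightarrow> nat \<Rightarrow> 'a" where
  "sv_array i k = fact i * fps_nth (sv_column k) i"

text \<open>With \<open>s = sv_base - 1\<close>, expand \<open>(1 + s) * (1 + x * s)\<close> in the
  product rule and sort by powers of \<open>s\<close>. The factor \<open>k + 1\<close> arises from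
  rescaling \<open>1 / fact k\<close> to \<open>1 / fact (Suc k)\<close>.\<close>

lemma fps_deriv_sv_column:
  "fps_deriv (sv_column k) =
    (if k = 0 then 0 else sv_column (k - 1)) +
    fps_const (y + of_nat k * (1 + x)) * sv_column k +
    fps_const (x * ((of_nat k + 1) * (of_nat k + y))) * sv_column (Suc k)"
proof -
  define s where "s = sv_base - 1"
  define f where "f = savage_viswanathan_gf x y"
  define X Y K where "X = fps_const x" and "Y = fps_const y" and "K = (of_nat k :: 'a fps)"
  have ds: "fps_deriv s = (1 + s) * (1 + X * s)"
    by (simp add: s_def X_def fps_deriv_sv_base)
  have df: "fps_deriv f = Y * (1 + X * s) * f"
    by (simp add: s_def X_def Y_def f_def fps_deriv_savage_viswanathan_gf)
  have const_eqs: "fps_const (y + of_nat k * (1 + x)) = Y + K * (1 + X)"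
    "fps_const (x * ((of_nat k + 1) * (of_nat k + y))) = (K + 1) * (X * (K + Y))"
    by (simp_all add: X_def Y_def K_def fps_of_nat mult_ac
        flip: fps_const_add fps_const_mult)
  have col: "sv_column j = fps_const (1 / fact j) * f * s ^ j" for j
    by (simp add: sv_column_def f_def s_def)
  have next_col: "(K + 1) * sv_column (Suc k) = fps_const (1 / fact k) * f * s ^ Suc k"
  proof -
    have "K + 1 = fps_const (of_nat (Suc k))"
      unfolding fps_of_nat by (simp add: K_def)
    moreover have "fps_const (of_nat (Suc k)) * fps_const (1 / fact (Suc k)) =
        fps_const (1 / fact k :: 'a)"
      by (simp del: of_nat_Suc)
    ultimately show ?thesis by (metis col mult.assoc)
  qed
  show ?thesis
  proof (cases k)
    case 0
    then show ?thesis
      using next_col unfolding const_eqs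
      by (simp add: col df K_def algebra_simps)
  next
    case (Suc m)
    have prev_col: "K * (fps_const (1 / fact k) * f * s ^ m) = sv_column m"
    proof -
      have "fps_const (of_nat k) * fps_const (1 / fact k) = fps_const (1 / fact m :: 'a)"
        by (simp add: Suc del: of_nat_Suc)
      then show ?thesis by (metis K_def col fps_of_nat mult.assoc)
    qed
    have "fps_deriv (s ^ k) = K * fps_deriv s * s ^ m"
      using fps_deriv_power'[of s k] by (simp add: Suc K_def)
    then have "fps_deriv (sv_column k) = fps_const (1 / fact k) *
        (Y * (1 + X * s) * f * s ^ k + f * (K * ((1 + s) * (1 + X * s)) * s ^ m))"
      by (simp add: col df ds algebra_simps)
    also have "\<dots> = K * (fps_const (1 / fact k) * f * s ^ m) +
        (Y + K * (1 + X)) * (fps_const (1 / fact k) * f * s ^ k) +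
        X * (K + Y) * (fps_const (1 / fact k) * f * s ^ Suc k)"
      by (simp add: Suc algebra_simps)
    also have "\<dots> = sv_column m + (Y + K * (1 + X)) * sv_column k +
        X * (K + Y) * ((K + 1) * sv_column (Suc k))"
      by (simp only: prev_col next_col col[of k])
    finally show ?thesis
      unfolding const_eqs by (simp add: Suc mult_ac)
  qed
qed

lemma stieltjes_array_sv:
  "stieltjes_array sv_array (\<lambda>k. y + of_nat k * (1 + x))
    (\<lambda>k. x * ((of_nat k + 1) * (of_nat k + y)))"
proof
  have f0: "fps_nth (savage_viswanathan_gf x y) 0 = 1"
    by (simp add: savage_viswanathan_gf_def fps_nth_general_power_0)
  show "sv_array 0 0 = 1"
    by (simp add: sv_array_def sv_column_def f0)
  show "sv_array 0 (Suc k) = 0" for k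
    by (simp add: sv_array_def sv_column_def sv_base_nth_0)
  \<comment> \<open>Differentiation shifts exponential coefficients, turning the column identity
    into a recurrence on rows.\<close>
  have step: "sv_array (Suc i) k = fact i * fps_nth (fps_deriv (sv_column k)) i" for i k
    by (simp add: sv_array_def algebra_simps)
  show "sv_array (Suc i) 0 = (y + of_nat 0 * (1 + x)) * sv_array i 0 +
      x * ((of_nat 0 + 1) * (of_nat 0 + y)) * sv_array i 1" for i
    unfolding step fps_deriv_sv_column
    by (simp add: sv_array_def algebra_simps)
  show "sv_array (Suc i) (Suc k) = sv_array i k +
      (y + of_nat (Suc k) * (1 + x)) * sv_array i (Suc k) +
      x * ((of_nat (Suc k) + 1) * (of_nat (Suc k) + y)) * sv_array i (Suc (Suc k))" for i k
    unfolding step fps_deriv_sv_column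
    by (simp add: sv_array_def distrib_left mult_ac del: of_nat_Suc)
qed

lemma hankel_transform_savage_viswanathan:
  "hankel_transform (\<lambda>k. savage_viswanathan k x y) n =
    (\<Prod>k\<le>n. \<Prod>j<k. x * ((of_nat j + 1) * (of_nat j + y)))"
proof -
  have "savage_viswanathan k x y = sv_array k 0" for k
    by (simp add: savage_viswanathan_def sv_array_def sv_column_def)
  then show ?thesis
    using stieltjes_array.hankel_transform_eq[OF stieltjes_array_sv] by simp
qed

end

lemma prod_superfactorial_form:
  fixes x y :: "'a::comm_ring_1"
  shows "(\<Prod>k\<le>n. \<Prod>j<k. x * ((of_nat j + 1) * (of_nat j + y))) =
    x ^ ((n + 1) choose 2) * y ^ n * (\<Prod>i = 1..n. ((of_nat i + 1) * (of_nat i + y)) ^ (n - i))"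
proof (induction n)
  case 0
  then show ?case by (simp add: binomial_eq_0)
next
  case (Suc n)
  define g where "g i = (of_nat i + 1) * (of_nat i + y)" for i
  have "(\<Prod>j<Suc n. x * g j) = x ^ Suc n * (g 0 * (\<Prod>i = 1..n. g i))"
    by (simp only: prod.distrib prod_constant card_lessThan lessThan_Suc_atMost
        atMost_atLeast0 card_atLeastAtMost diff_zero prod.atLeast_Suc_atMost One_nat_def)
  \<comment> \<open>The factor at \<open>i = Suc n\<close> has exponent 0; every other exponent
    grows by one.\<close>
  moreover have "(\<Prod>i = 1..Suc n. g i ^ (Suc n - i)) =
      (\<Prod>i = 1..n. g i ^ (n - i)) * (\<Prod>i = 1..n. g i)"
    by (simp add: Suc_diff_le mult.commute flip: prod.distrib)
  moreover have "(Suc n + 1) choose 2 = ((n + 1) choose 2) + Suc n"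
    by (simp add: numeral_2_eq_2)
  moreover have "g 0 = y" by (simp add: g_def)
  ultimately show ?case
    using Suc.IH unfolding g_def[symmetric] by (simp add: power_add mult_ac)
qed

theorem corollary8:
  fixes n :: nat
  shows "hankel_transform (\<lambda>k. savage_viswanathan k indet_x indet_y) n =
    indet_x ^ ((n + 1) choose 2) * indet_y ^ n *
      (\<Prod>i = 1..n. ((of_nat i + 1) * (of_nat i + indet_y)) ^ (n - i))"
proof -
  \<comment> \<open>The embedding into the fraction field is injective, so polynomials are
    compared.\<close>
  have "indet_x \<noteq> 1"
    unfolding indet_x_def to_fract_1[symmetric] to_fract_eq_iff by (simp add: one_pCons)
  show ?thesis
    by (simp only: hankel_transform_savage_viswanathan[OF \<open>indet_x \<noteq> 1\<close>] prod_superfactorial_form)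
qed

end
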